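(* Let $k\geq 5$ be an odd integer and let $S=\{1,2,\dots,\frac{k-1}{2}\}$. The generalized Johnson graph $J_S(2k,k)$, whose vertices are the $k$-element subsets of $\{1,\dots,2k\}$ with two vertices adjacent if and only if the size of their intersection lies in $S$, is not determined by its spectrum; that is, there exists a graph that is cospectral with it but not isomorphic to it.
   Context: All graphs are simple and loopless. The spectrum of a graph is the multiset of eigenvalues of its adjacency matrix. Two graphs are cospectral if they have the same spectrum. A graph is determined by its spectrum if every graph cospectral with it is isomorphic to it. *)

theory Defs
  imports
    "Jordan_Normal_Form.Char_Poly"
    "Graph_Theory.Pair_Digraph"
    "Graph_Theory.Digraph_Isomorphism"
    "HOL-Computational_Algebra.Fundamental_Theorem_Algebra"
begin

text \<open>
  A (finite, simple, loopless) graph is a \<^locale>\<open>pair_graph\<close>: a finite vertex set together with a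
  symmetric, irreflexive arc relation on it, so that an undirected edge is a pair of opposite arcs.
  Isomorphism is \<^const>\<open>digraph_iso\<close>; lemma \<open>digraph_iso_pair_graph_iff\<close> below spells it out
  for such graphs.
\<close>

definition adjacency_matrix :: "'a list \<Rightarrow> 'a pair_pre_digraph \<Rightarrow> complex mat" where
  "adjacency_matrix vs G =
     mat (length vs) (length vs) (\<lambda>(i, j). if (vs ! i, vs ! j) \<in> parcs G then 1 else 0)"

text \<open>
  Matrices are indexed by natural numbers, so an ordering of the vertices has to be chosen; by
  lemma \<open>graph_spectrum_eq\<close> the choice is irrelevant. Eigenvalues are taken with their algebraic
  multiplicity as complex numbers, so the spectrum always has as many members as there are vertices.
\<close>

definition graph_spectrum :: "'a pair_pre_digraph \<Rightarrow> complex multiset" where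
  "graph_spectrum G =
     proots (char_poly (adjacency_matrix (SOME vs. distinct vs \<and> set vs = pverts G) G))"

definition cospectral :: "'a pair_pre_digraph \<Rightarrow> 'b pair_pre_digraph \<Rightarrow> bool" where
  "cospectral G H \<longleftrightarrow> graph_spectrum G = graph_spectrum H"

text \<open>
  A quantifier cannot range over vertex types; since every finite graph is isomorphic to one whose
  vertices are natural numbers, the competing graphs \<open>H\<close> may be taken over \<^typ>\<open>nat\<close>.
\<close>

definition determined_by_spectrum :: "'a pair_pre_digraph \<Rightarrow> bool" where
  "determined_by_spectrum G \<longleftrightarrow>
     (\<forall>H :: nat pair_pre_digraph. pair_graph H \<longrightarrow> cospectral H G \<longrightarrow>
        digraph_iso (with_proj H) (with_proj G))"

text \<open>
  The condition \<open>A \<noteq> B\<close> keeps the graph loopless for every \<open>S\<close>; it is redundant if \<open>k \<notin> S\<close>.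
\<close>

definition gen_johnson :: "nat set \<Rightarrow> nat \<Rightarrow> nat \<Rightarrow> nat set pair_pre_digraph" where
  "gen_johnson S n k =
     \<lparr> pverts = {A. A \<subseteq> {1..n} \<and> card A = k},
       parcs = {(A, B). A \<subseteq> {1..n} \<and> card A = k \<and> B \<subseteq> {1..n} \<and> card B = k \<and>
                        A \<noteq> B \<and> card (A \<inter> B) \<in> S} \<rparr>"


lemma pair_graph_gen_johnson: "pair_graph (gen_johnson S n k)"
proof -
  let ?V = "{A. A \<subseteq> {1..n} \<and> card A = k}"
  have fin: "finite ?V" by (rule finite_subset[of _ "Pow {1..n}"]) auto
  have "parcs (gen_johnson S n k) \<subseteq> ?V \<times> ?V" by (auto simp: gen_johnson_def)
  hence "finite (parcs (gen_johnson S n k))" by (rule finite_subset[OF _ finite_cartesian_product[OF fin fin]])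
  moreover have "sym (parcs (gen_johnson S n k))"
  proof (rule symI)
    fix A B assume "(A, B) \<in> parcs (gen_johnson S n k)"
    thus "(B, A) \<in> parcs (gen_johnson S n k)"
      unfolding gen_johnson_def by (simp add: Int_commute) blast
  qed
  moreover have "fst e \<in> pverts (gen_johnson S n k) \<and> snd e \<in> pverts (gen_johnson S n k) \<and> fst e \<noteq> snd e"
    if "e \<in> parcs (gen_johnson S n k)" for e
    using that by (cases e) (simp add: gen_johnson_def)
  moreover have "finite (pverts (gen_johnson S n k))" using fin by (simp add: gen_johnson_def)
  moreover have "symmetric (with_proj (gen_johnson S n k))"
    using calculation by (simp add: symmetric_def)
  ultimately show ?thesis
    by (simp add: pair_graph_def pair_digraph_def pair_fin_digraph_def pair_wf_digraph_def
        pair_pseudo_graph_def pair_sym_digraph_def pair_loopfree_digraph_def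
        pair_fin_digraph_axioms_def pair_sym_digraph_axioms_def pair_loopfree_digraph_axioms_def)
qed

lemma adjacency_matrix_carrier [simp]:
  "adjacency_matrix vs G \<in> carrier_mat (length vs) (length vs)"
  by (simp add: adjacency_matrix_def)

lemma similar_adjacency_matrix:
  assumes vs: "distinct vs" and ws: "distinct ws" and eq: "set vs = set ws"
  shows "similar_mat (adjacency_matrix vs G) (adjacency_matrix ws G)"
proof -
  define n where "n = length vs"
  have n: "length vs = n" "length ws = n"
    using distinct_card[OF vs] distinct_card[OF ws] eq by (simp_all add: n_def)
  have "\<forall>i<n. \<exists>j<n. ws ! j = vs ! i"
    using eq n by (metis in_set_conv_nth nth_mem)
  then obtain p where p: "\<And>i. i < n \<Longrightarrow> p i < n" "\<And>i. i < n \<Longrightarrow> ws ! p i = vs ! i"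
    by metis
  have "\<forall>j<n. \<exists>i<n. ws ! j = vs ! i"
    using eq n by (metis in_set_conv_nth nth_mem)
  then obtain q where q: "\<And>i. i < n \<Longrightarrow> q i < n" "\<And>j. j < n \<Longrightarrow> vs ! q j = ws ! j"
    by metis
  have pq: "i = q j \<longleftrightarrow> j = p i" if "i < n" "j < n" for i j
    using that p q vs ws n by (metis nth_eq_iff_index_eq)
  define P :: "complex mat" where "P = mat n n (\<lambda>(i, j). if j = p i then 1 else 0)"
  define Q :: "complex mat" where "Q = mat n n (\<lambda>(i, j). if j = q i then 1 else 0)"
  let ?A = "adjacency_matrix vs G" and ?B = "adjacency_matrix ws G"
  have carr: "?A \<in> carrier_mat n n" "?B \<in> carrier_mat n n" "P \<in> carrier_mat n n" "Q \<in> carrier_mat n n"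
    using adjacency_matrix_carrier[of vs G] adjacency_matrix_carrier[of ws G]
    unfolding n P_def Q_def by auto
  have qp: "q (p i) = i" "p (q i) = i" if "i < n" for i
    using pq[OF that p(1)[OF that]] pq[OF q(1)[OF that] that] by auto
  have delta: "(\<Sum>k = 0..<n. (if k = m then 1 else 0) * f k) = f m" if "m < n" for m and f :: "nat \<Rightarrow> complex"
    using that by (simp add: sum.delta if_distrib[of "\<lambda>x. x * _"] cong: if_cong)
  have PQ: "P * Q = 1\<^sub>m n"
    by (rule eq_matI) (auto simp: P_def Q_def scalar_prod_def delta p qp)
  have QP: "Q * P = 1\<^sub>m n"
    by (rule eq_matI) (auto simp: P_def Q_def scalar_prod_def delta q qp)
  have PB: "(P * ?B) $$ (i, j) = ?B $$ (p i, j)" if "i < n" "j < n" for i j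
    using that carr p(1)[OF that(1)] by (simp add: P_def scalar_prod_def delta)
  have "?A = P * ?B * Q"
  proof (rule eq_matI)
    fix i j assume "i < dim_row (P * ?B * Q)" "j < dim_col (P * ?B * Q)"
    hence ij: "i < n" "j < n" using carr by auto
    have "(P * ?B * Q) $$ (i, j) = (\<Sum>k = 0..<n. ?B $$ (p i, k) * (if j = q k then 1 else 0))"
      using ij carr PB by (simp add: Q_def scalar_prod_def)
    also have "\<dots> = (\<Sum>k = 0..<n. (if k = p j then 1 else 0) * ?B $$ (p i, k))"
      using ij pq by (intro sum.cong) auto
    also have "\<dots> = ?B $$ (p i, p j)" using p(1)[OF ij(2)] by (rule delta)
    also have "\<dots> = ?A $$ (i, j)" using ij p n by (simp add: adjacency_matrix_def)
    finally show "?A $$ (i, j) = (P * ?B * Q) $$ (i, j)" by simp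
  qed (use carr in auto)
  with carr PQ QP show ?thesis by (intro similar_matI[of _ _ P Q n]) auto
qed

lemma graph_spectrum_eq:
  assumes "distinct vs" "set vs = pverts G"
  shows "graph_spectrum G = proots (char_poly (adjacency_matrix vs G))"
proof -
  let ?ws = "SOME vs. distinct vs \<and> set vs = pverts G"
  have "distinct ?ws \<and> set ?ws = pverts G" using assms by (intro someI) auto
  with assms show ?thesis
    unfolding graph_spectrum_def by (metis char_poly_similar similar_adjacency_matrix)
qed

lemma
  assumes vs: "distinct vs" "set vs = pverts G"
  shows size_graph_spectrum: "size (graph_spectrum G) = card (pverts G)"
    and set_graph_spectrum: "set_mset (graph_spectrum G) = Collect (eigenvalue (adjacency_matrix vs G))"
proof -
  let ?A = "adjacency_matrix vs G"
  have d: "degree (char_poly ?A) = length vs \<and> coeff (char_poly ?A) (length vs) = 1"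
    by (rule degree_monic_char_poly) simp
  hence "char_poly ?A \<noteq> 0" by auto
  with d show "size (graph_spectrum G) = card (pverts G)"
    "set_mset (graph_spectrum G) = Collect (eigenvalue ?A)"
    using vs distinct_card[of vs] eigenvalue_root_char_poly[OF adjacency_matrix_carrier]
    by (auto simp: graph_spectrum_eq[OF vs] size_proots_complex)
qed

lemma digraph_iso_pair_graph_iff:
  fixes G :: "'a pair_pre_digraph" and H :: "'b pair_pre_digraph"
  assumes G: "pair_graph G" and H: "pair_graph H"
  shows "digraph_iso (with_proj G) (with_proj H) \<longleftrightarrow>
    (\<exists>f. bij_betw f (pverts G) (pverts H) \<and>
       (\<forall>u\<in>pverts G. \<forall>v\<in>pverts G. (u, v) \<in> parcs G \<longleftrightarrow> (f u, f v) \<in> parcs H))"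
    (is "?L \<longleftrightarrow> ?R")
proof
  interpret G: pair_graph G by fact
  interpret H: pair_graph H by fact
  assume ?L
  then obtain h where h: "pre_digraph.digraph_isomorphism (with_proj G) h"
    and H_eq: "with_proj H = app_iso h (with_proj G)"
    unfolding digraph_iso_def by auto
  let ?f = "iso_verts h"
  have tl: "iso_tail h = fst" "iso_head h = snd"
    and V: "pverts H = ?f ` pverts G" and E: "parcs H = iso_arcs h ` parcs G"
    using H_eq by (auto simp: with_proj_def app_iso_def)
  have inj: "inj_on ?f (pverts G)"
    and arc: "\<And>u v. (u, v) \<in> parcs G \<Longrightarrow> iso_arcs h (u, v) = (?f u, ?f v)"
    using h tl by (fastforce simp: pre_digraph.digraph_isomorphism_def prod_eq_iff)+
  have "(u, v) \<in> parcs G \<longleftrightarrow> (?f u, ?f v) \<in> parcs H" if uv: "u \<in> pverts G" "v \<in> pverts G" for u v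
  proof
    assume "(u, v) \<in> parcs G"
    thus "(?f u, ?f v) \<in> parcs H" using arc E by force
  next
    assume "(?f u, ?f v) \<in> parcs H"
    then obtain a b where ab: "(a, b) \<in> parcs G" "(?f u, ?f v) = iso_arcs h (a, b)"
      using E by auto
    hence "?f u = ?f a" "?f v = ?f b" using arc by auto
    moreover have "a \<in> pverts G" "b \<in> pverts G" using ab(1) G.wellformed' by auto
    ultimately have "u = a" "v = b" using inj uv by (auto dest: inj_onD)
    with ab show "(u, v) \<in> parcs G" by simp
  qed
  with inj V show ?R by (auto simp: bij_betw_def)
next
  interpret G: pair_graph G by fact
  interpret H: pair_graph H by fact
  assume ?R
  then obtain f where f: "bij_betw f (pverts G) (pverts H)"
    and adj: "\<And>u v. u \<in> pverts G \<Longrightarrow> v \<in> pverts G \<Longrightarrow> (u, v) \<in> parcs G \<longleftrightarrow> (f u, f v) \<in> parcs H"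
    by blast
  define h where "h = \<lparr> iso_verts = f, iso_arcs = map_prod f f, iso_head = snd, iso_tail = fst \<rparr>"
  have inj: "inj_on f (pverts G)" and V: "pverts H = f ` pverts G"
    using f by (auto simp: bij_betw_def)
  have "inj_on (map_prod f f) (parcs G)"
    by (rule inj_on_subset[OF map_prod_inj_on[OF inj inj]]) (auto dest: G.wellformed')
  hence "pre_digraph.digraph_isomorphism (with_proj G) h"
    using inj G.wf_digraph
    by (auto simp: pre_digraph.digraph_isomorphism_def h_def)
  moreover have "parcs H = map_prod f f ` parcs G"
  proof (rule Set.set_eqI)
    fix e :: "'b \<times> 'b"
    obtain x y where e: "e = (x, y)" by (cases e)
    show "e \<in> parcs H \<longleftrightarrow> e \<in> map_prod f f ` parcs G"
    proof
      assume xy: "e \<in> parcs H"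
      hence "x \<in> pverts H" "y \<in> pverts H" using H.wellformed'[of x y] e by auto
      then obtain u v where uv: "u \<in> pverts G" "v \<in> pverts G" "x = f u" "y = f v"
        using V by blast
      hence "(u, v) \<in> parcs G" using adj[of u v] xy e by simp
      with uv e show "e \<in> map_prod f f ` parcs G" by (metis image_eqI map_prod_simp)
    next
      assume "e \<in> map_prod f f ` parcs G"
      then obtain u v where uv: "(u, v) \<in> parcs G" "e = (f u, f v)" by (elim imageE) (metis map_prod_simp surj_pair)
      with adj[of u v] G.wellformed'[OF uv(1)] show "e \<in> parcs H" by simp
    qed
  qed
  hence "with_proj H = app_iso h (with_proj G)"
    using V by (simp add: with_proj_def app_iso_def h_def)
  ultimately show ?L unfolding digraph_iso_def by blast
qed

end

theory Submission
  imports Defs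
begin

text \<open>
  Write \<open>k = 2 m + 1\<close> and let \<open>T\<close> be a set of \<open>k + 1\<close> points. The \<open>k\<close>-subsets \<open>T - {t}\<close> and their
  complements form two Godsil--McKay switching sets: any other vertex \<open>Z\<close> is adjacent to all or none
  of each, except that it is adjacent to half of each if it meets \<open>T\<close> in \<open>m + 1\<close> points. Switching is
  conjugation of the adjacency matrix by \<open>2 P - I\<close>, where \<open>P\<close> averages over the cells, so the squares
  of the two adjacency matrices are conjugate in the same way. In the original graph, vertices meeting
  in \<open>i\<close> points have \<open>f i\<close> common neighbours, with \<open>f\<close> strictly increasing on \<open>m < i < k\<close>, while in
  the switched graph some non-adjacent pair has
  \<open>f (k - 2) + 4 / (k + 1) * (f (k - 1) - f (k - 2))\<close> common neighbours. This lies strictly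
  between the two largest values \<open>f (k - 2)\<close> and \<open>f (k - 1)\<close> that are possible for distinct
  non-adjacent vertices of the original graph.
\<close>

subsection \<open>Graphs, spectra and common neighbours\<close>

lemma pair_graphI:
  fixes G :: "'a pair_pre_digraph"
  assumes "finite (pverts G)"
    and "\<And>x y. (x, y) \<in> parcs G \<Longrightarrow> x \<in> pverts G \<and> y \<in> pverts G \<and> x \<noteq> y \<and> (y, x) \<in> parcs G"
  shows "pair_graph G"
proof -
  have "parcs G \<subseteq> pverts G \<times> pverts G" using assms(2) by auto
  hence "finite (parcs G)" using assms(1) by (meson finite_SigmaI finite_subset)
  moreover have "sym (parcs G)" using assms(2) by (auto intro: symI)
  moreover have "fst e \<in> pverts G \<and> snd e \<in> pverts G \<and> fst e \<noteq> snd e" if "e \<in> parcs G" for e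
    using that assms(2) by (cases e) auto
  moreover have "symmetric (with_proj G)"
    using calculation by (simp add: symmetric_def)
  ultimately show ?thesis using assms(1)
    by (simp add: pair_graph_def pair_digraph_def pair_fin_digraph_def pair_wf_digraph_def
        pair_pseudo_graph_def pair_sym_digraph_def pair_loopfree_digraph_def
        pair_fin_digraph_axioms_def pair_sym_digraph_axioms_def pair_loopfree_digraph_axioms_def)
qed

lemma pair_graphD:
  fixes G :: "'a pair_pre_digraph"
  assumes "pair_graph G"
  shows "finite (pverts G)"
    and "(x, y) \<in> parcs G \<Longrightarrow> x \<in> pverts G \<and> y \<in> pverts G \<and> x \<noteq> y \<and> (y, x) \<in> parcs G"
proof -
  interpret pair_graph G by fact
  show "finite (pverts G)" by (rule pair_finite_verts)
  assume "(x, y) \<in> parcs G"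
  thus "x \<in> pverts G \<and> y \<in> pverts G \<and> x \<noteq> y \<and> (y, x) \<in> parcs G"
    using wellformed'[of x y] no_loops'[of x y] arcs_symmetric by auto
qed

text \<open>The definition quantifies over competitors on natural numbers only. Numbering the
  vertices of \<open>H\<close> along a list \<open>vs\<close> gives such a competitor with literally
  the same adjacency matrix, so graphs on any vertex type can be used.\<close>

lemma determined_by_spectrumD:
  fixes G H :: "'a pair_pre_digraph"
  assumes det: "determined_by_spectrum G" and G: "pair_graph G" and H: "pair_graph H"
    and cosp: "cospectral H G"
  shows "\<exists>f. bij_betw f (pverts H) (pverts G) \<and>
    (\<forall>x\<in>pverts H. \<forall>y\<in>pverts H. (x, y) \<in> parcs H \<longleftrightarrow> (f x, f y) \<in> parcs G)"
proof -
  obtain vs where vs: "distinct vs" "set vs = pverts H"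
    using finite_distinct_list[OF pair_graphD(1)[OF H]] by blast
  let ?n = "length vs"
  define H' where "H' = \<lparr> pverts = {..<?n}, parcs = {(i, j). i < ?n \<and> j < ?n \<and> (vs ! i, vs ! j) \<in> parcs H} \<rparr>"
  have H': "pair_graph H'"
    by (rule pair_graphI) (use pair_graphD[OF H] in \<open>auto simp: H'_def\<close>)
  have "adjacency_matrix [0..<?n] H' = adjacency_matrix vs H"
    by (rule eq_matI) (auto simp: adjacency_matrix_def H'_def)
  moreover have "graph_spectrum H' = proots (char_poly (adjacency_matrix [0..<?n] H'))"
    by (rule graph_spectrum_eq) (auto simp: H'_def)
  ultimately have "cospectral H' G"
    using cosp graph_spectrum_eq[OF vs] by (simp add: cospectral_def)
  hence "digraph_iso (with_proj H') (with_proj G)"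
    using det H' by (simp add: determined_by_spectrum_def)
  then obtain f where f: "bij_betw f (pverts H') (pverts G)"
    and adj: "\<And>i j. i \<in> pverts H' \<Longrightarrow> j \<in> pverts H' \<Longrightarrow> (i, j) \<in> parcs H' \<longleftrightarrow> (f i, f j) \<in> parcs G"
    unfolding digraph_iso_pair_graph_iff[OF H' G] by blast
  have nth: "bij_betw ((!) vs) {..<?n} (pverts H)"
    using vs by (simp add: bij_betw_nth)
  let ?g = "inv_into {..<?n} ((!) vs)"
  have g: "bij_betw ?g (pverts H) {..<?n}" by (rule bij_betw_inv_into[OF nth])
  have g': "?g x < ?n" "vs ! ?g x = x" if "x \<in> pverts H" for x
    using bij_betwE[OF g] that bij_betw_inv_into_right[OF nth that] by auto
  have "bij_betw (f \<circ> ?g) (pverts H) (pverts G)"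
    using g f by (intro bij_betw_trans) (auto simp: H'_def)
  moreover have "(x, y) \<in> parcs H \<longleftrightarrow> (f (?g x), f (?g y)) \<in> parcs G"
    if "x \<in> pverts H" "y \<in> pverts H" for x y
    using adj[of "?g x" "?g y"] g'[OF that(1)] g'[OF that(2)] by (simp add: H'_def)
  ultimately show ?thesis by (intro exI[of _ "f \<circ> ?g"]) auto
qed

definition common_nbrs :: "'a pair_pre_digraph \<Rightarrow> 'a \<Rightarrow> 'a \<Rightarrow> 'a set" where
  "common_nbrs G x y = {z \<in> pverts G. (x, z) \<in> parcs G \<and> (z, y) \<in> parcs G}"

lemma card_common_nbrs_iso:
  assumes f: "bij_betw f (pverts H) (pverts G)"
    and adj: "\<And>x y. x \<in> pverts H \<Longrightarrow> y \<in> pverts H \<Longrightarrow> (x, y) \<in> parcs H \<longleftrightarrow> (f x, f y) \<in> parcs G"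
    and xy: "x \<in> pverts H" "y \<in> pverts H"
  shows "card (common_nbrs H x y) = card (common_nbrs G (f x) (f y))"
proof -
  have V: "pverts G = f ` pverts H" using f by (simp add: bij_betw_def)
  have "common_nbrs G (f x) (f y) = f ` common_nbrs H x y"
    unfolding common_nbrs_def V using adj xy by auto
  moreover have "inj_on f (common_nbrs H x y)"
    using f by (auto simp: bij_betw_def common_nbrs_def intro: inj_on_subset)
  ultimately show ?thesis by (simp add: card_image)
qed

text \<open>Complex values make this the entry of the adjacency matrix and allow averages over
  cells.\<close>

definition adj :: "'a pair_pre_digraph \<Rightarrow> 'a \<Rightarrow> 'a \<Rightarrow> complex" where
  "adj G x y = of_bool ((x, y) \<in> parcs G)"

text \<open>The entries of the squared adjacency matrix count walks of length two. This lets common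
  neighbours be read off from matrix identities.\<close>

lemma card_common_nbrs_eq_sum:
  assumes "finite (pverts G)"
  shows "of_nat (card (common_nbrs G x y)) = (\<Sum>z\<in>pverts G. adj G x z * adj G z y)"
proof -
  have "(\<Sum>z\<in>pverts G. adj G x z * adj G z y)
      = (\<Sum>z\<in>pverts G. of_bool (z \<in> common_nbrs G x y))"
    by (intro sum.cong) (auto simp: adj_def common_nbrs_def)
  also have "\<dots> = of_nat (card (pverts G \<inter> common_nbrs G x y))"
    using assms by (simp add: of_bool_def sum.If_cases Int_def)
  also have "pverts G \<inter> common_nbrs G x y = common_nbrs G x y"
    by (auto simp: common_nbrs_def)
  finally show ?thesis by simp
qed

subsection \<open>Godsil--McKay switching\<close>

text \<open>
  \<open>cell x\<close> is the cell of \<open>x\<close>, a singleton for the vertices outside the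
  switching sets. With \<open>P\<close> the averaging operator over the cells, assumption \<open>switch\<close> says
  \<open>A' (2 P - I) = (2 P - I) A\<close> for the adjacency matrices \<open>A\<close> of \<open>G\<close> and \<open>A'\<close> of \<open>H\<close>.
\<close>

locale gm_switching =
  fixes G H :: "'a pair_pre_digraph" and cell :: "'a \<Rightarrow> 'a set"
  assumes finite_verts: "finite (pverts G)"
    and verts_eq: "pverts H = pverts G"
    and cell_self: "x \<in> pverts G \<Longrightarrow> x \<in> cell x"
    and cell_subset: "x \<in> pverts G \<Longrightarrow> cell x \<subseteq> pverts G"
    and cell_eq: "x \<in> pverts G \<Longrightarrow> y \<in> cell x \<Longrightarrow> cell y = cell x"
    and switch: "x \<in> pverts G \<Longrightarrow> y \<in> pverts G \<Longrightarrow>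
      adj H x y - adj G x y =
        2 * ((\<Sum>z\<in>cell y. adj H x z) / of_nat (card (cell y))
           - (\<Sum>z\<in>cell x. adj G z y) / of_nat (card (cell x)))"
begin

text \<open>The entries of \<open>2 P - I\<close>.\<close>

definition reflection :: "'a \<Rightarrow> 'a \<Rightarrow> complex" where
  "reflection x y = 2 * of_bool (y \<in> cell x) / of_nat (card (cell x)) - of_bool (x = y)"

lemma card_cell_pos: "x \<in> pverts G \<Longrightarrow> card (cell x) > 0"
  using cell_self cell_subset finite_verts by (metis card_gt_0_iff empty_iff finite_subset)

lemma sum_reflection_left:
  assumes "x \<in> pverts G"
  shows "(\<Sum>z\<in>pverts G. reflection x z * g z) = 2 * (\<Sum>z\<in>cell x. g z) / of_nat (card (cell x)) - g x"
proof -
  have "(\<Sum>z\<in>pverts G. reflection x z * g z)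
      = (\<Sum>z\<in>pverts G. (if z \<in> cell x then 2 * g z / of_nat (card (cell x)) else 0))
        - (\<Sum>z\<in>pverts G. if z = x then g z else 0)"
    unfolding sum_subtractf[symmetric] by (intro sum.cong) (auto simp: reflection_def algebra_simps)
  also have "\<dots> = (\<Sum>z\<in>cell x. 2 * g z / of_nat (card (cell x))) - g x"
    using assms finite_verts cell_subset[OF assms]
    by (simp add: sum.If_cases Int_absorb1)
  finally show ?thesis by (simp add: sum_divide_distrib sum_distrib_left)
qed

lemma reflection_sym:
  assumes "x \<in> pverts G" "y \<in> pverts G"
  shows "reflection x y = reflection y x"
proof -
  have "y \<in> cell x \<longleftrightarrow> x \<in> cell y" "y \<in> cell x \<Longrightarrow> cell y = cell x"
    using assms cell_self cell_eq by blast+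
  thus ?thesis by (auto simp: reflection_def)
qed

lemma sum_reflection_right:
  assumes "y \<in> pverts G"
  shows "(\<Sum>z\<in>pverts G. g z * reflection z y) = 2 * (\<Sum>z\<in>cell y. g z) / of_nat (card (cell y)) - g y"
  unfolding sum_reflection_left[OF assms, symmetric]
  using assms by (intro sum.cong) (auto simp: reflection_sym)

text \<open>\<open>P\<close> is idempotent, so \<open>2 P - I\<close> is an involution. The proof
  uses \<open>P (2 P - I) = P\<close>: averaging a column of \<open>reflection\<close> over a cell
  returns the entry of \<open>P\<close>.\<close>

lemma reflection_comp:
  assumes x: "x \<in> pverts G" and y: "y \<in> pverts G"
  shows "(\<Sum>z\<in>pverts G. reflection x z * reflection z y) = of_bool (x = y)"
proof -
  have fin: "finite (cell x)" using finite_verts cell_subset[OF x] by (rule rev_finite_subset)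
  have "(\<Sum>z\<in>cell x. reflection z y)
      = (\<Sum>z\<in>cell x. 2 * of_bool (y \<in> cell x) / of_nat (card (cell x)) - (if z = y then 1 else 0))"
    using cell_eq[OF x] by (intro sum.cong) (auto simp: reflection_def)
  also have "\<dots> = of_bool (y \<in> cell x)"
    using fin card_cell_pos[OF x] by (auto simp: sum_subtractf)
  finally show ?thesis unfolding sum_reflection_left[OF x] by (simp add: reflection_def)
qed

text \<open>Assumption \<open>switch\<close> rearranged into the intertwining relation, entry by
  entry.\<close>

lemma adj_reflection:
  assumes "x \<in> pverts G" "y \<in> pverts G"
  shows "(\<Sum>z\<in>pverts G. adj H x z * reflection z y) = (\<Sum>z\<in>pverts G. reflection x z * adj G z y)"
  unfolding sum_reflection_left[OF assms(1)] sum_reflection_right[OF assms(2)]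
  using switch[OF assms] by (simp add: algebra_simps)

lemma cospectral: "cospectral H G"
proof -
  obtain vs where vs: "distinct vs" "set vs = pverts G"
    using finite_distinct_list[OF finite_verts] by blast
  let ?n = "length vs"
  let ?A = "adjacency_matrix vs G" and ?B = "adjacency_matrix vs H"
  define Q where "Q = mat ?n ?n (\<lambda>(i, j). reflection (vs ! i) (vs ! j))"
  have sum_vs: "(\<Sum>i = 0..<?n. g (vs ! i)) = (\<Sum>x\<in>pverts G. g x)" for g :: "'a \<Rightarrow> complex"
    by (rule sum.reindex_bij_betw) (use vs in \<open>simp add: bij_betw_nth atLeast0LessThan\<close>)
  have mem: "vs ! i \<in> pverts G" if "i < ?n" for i
    unfolding vs(2)[symmetric] using that by (rule nth_mem)
  have dims: "dim_row ?A = ?n" "dim_col ?A = ?n" "dim_row ?B = ?n" "dim_col ?B = ?n"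
    "dim_row Q = ?n" "dim_col Q = ?n"
    by (simp_all add: adjacency_matrix_def Q_def)
  have carr: "?A \<in> carrier_mat ?n ?n" "?B \<in> carrier_mat ?n ?n" "Q \<in> carrier_mat ?n ?n"
    by (simp_all add: Q_def)
  have ent: "?A $$ (i, j) = adj G (vs ! i) (vs ! j)" "?B $$ (i, j) = adj H (vs ! i) (vs ! j)"
    "Q $$ (i, j) = reflection (vs ! i) (vs ! j)" if "i < ?n" "j < ?n" for i j
    using that by (simp_all add: adjacency_matrix_def adj_def Q_def)
  have QQ: "Q * Q = 1\<^sub>m ?n"
  proof (rule eq_matI)
    fix i j assume "i < dim_row (1\<^sub>m ?n :: complex mat)" "j < dim_col (1\<^sub>m ?n :: complex mat)"
    hence ij: "i < ?n" "j < ?n" by auto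
    have "(Q * Q) $$ (i, j) = (\<Sum>l = 0..<?n. reflection (vs ! i) (vs ! l) * reflection (vs ! l) (vs ! j))"
      using ij dims ent by (simp add: scalar_prod_def)
    also have "\<dots> = of_bool (vs ! i = vs ! j)"
      unfolding sum_vs[of "\<lambda>x. reflection (vs ! i) x * reflection x (vs ! j)"] by (rule reflection_comp[OF mem mem]) fact+
    also have "\<dots> = 1\<^sub>m ?n $$ (i, j)"
      using ij vs by (simp add: nth_eq_iff_index_eq)
    finally show "(Q * Q) $$ (i, j) = 1\<^sub>m ?n $$ (i, j)" .
  qed (use dims in auto)
  have BQ: "?B * Q = Q * ?A"
  proof (rule eq_matI)
    fix i j assume "i < dim_row (Q * ?A)" "j < dim_col (Q * ?A)"
    hence ij: "i < ?n" "j < ?n" using dims by auto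
    have "(?B * Q) $$ (i, j) = (\<Sum>l = 0..<?n. adj H (vs ! i) (vs ! l) * reflection (vs ! l) (vs ! j))"
      using ij dims ent by (simp add: scalar_prod_def)
    also have "\<dots> = (\<Sum>l = 0..<?n. reflection (vs ! i) (vs ! l) * adj G (vs ! l) (vs ! j))"
      unfolding sum_vs[of "\<lambda>x. adj H (vs ! i) x * reflection x (vs ! j)"]
        sum_vs[of "\<lambda>x. reflection (vs ! i) x * adj G x (vs ! j)"]
      by (rule adj_reflection[OF mem mem]) fact+
    also have "\<dots> = (Q * ?A) $$ (i, j)"
      using ij dims ent by (simp add: scalar_prod_def)
    finally show "(?B * Q) $$ (i, j) = (Q * ?A) $$ (i, j)" .
  qed (use dims in auto)
  \<comment> \<open>Since \<open>Q\<close> is its own inverse, the intertwining relation is a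
    similarity.\<close>
  have "?B = ?B * (Q * Q)" by (simp only: QQ right_mult_one_mat[OF carr(2)])
  also have "\<dots> = ?B * Q * Q" using carr by (metis assoc_mult_mat)
  also have "\<dots> = Q * ?A * Q" by (simp add: BQ)
  finally have B: "?B = Q * ?A * Q" .
  have "similar_mat ?B ?A"
    by (rule similar_matI[OF _ QQ QQ B]) (use carr in simp)
  hence "char_poly ?B = char_poly ?A" by (rule char_poly_similar)
  thus ?thesis
    using vs verts_eq by (simp add: cospectral_def graph_spectrum_eq[of vs])
qed

text \<open>
  The square of the intertwining relation, \<open>A'\<^sup>2 (2 P - I) = (2 P - I) A\<^sup>2\<close>, in a column where
  \<open>2 P - I\<close> is trivial.
\<close>

lemma card_common_nbrs_switched:
  assumes x: "x \<in> pverts G" and y: "y \<in> pverts G" and cell_y: "cell y = {y}"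
  shows "card (cell x) * (card (common_nbrs H x y) + card (common_nbrs G x y))
    = 2 * (\<Sum>z\<in>cell x. card (common_nbrs G z y))"
proof -
  let ?V = "pverts G"
  have "of_nat (card (common_nbrs H x y)) = (\<Sum>w\<in>?V. adj H x w * adj H w y)"
    using card_common_nbrs_eq_sum[of H] finite_verts verts_eq by simp
  \<comment> \<open>The cell of \<open>y\<close> is a singleton, so column \<open>y\<close> of
    \<open>A'\<close> is also column \<open>y\<close> of \<open>A' (2 P - I)\<close>. The relation
    turns it into a column of \<open>(2 P - I) A\<close>; a second use below moves the reflection
    past the other factor \<open>A'\<close>.\<close>
  also have "\<dots> = (\<Sum>w\<in>?V. adj H x w * (\<Sum>z\<in>?V. reflection w z * adj G z y))"
  proof (intro sum.cong arg_cong[of _ _ "(*) _"] refl)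
    fix w assume "w \<in> ?V"
    from adj_reflection[OF this y] show "adj H w y = (\<Sum>z\<in>?V. reflection w z * adj G z y)"
      unfolding sum_reflection_right[OF y] by (simp add: cell_y)
  qed
  also have "\<dots> = (\<Sum>w\<in>?V. \<Sum>z\<in>?V. adj H x w * reflection w z * adj G z y)"
    by (simp add: sum_distrib_left mult.assoc)
  also have "\<dots> = (\<Sum>z\<in>?V. \<Sum>w\<in>?V. adj H x w * reflection w z * adj G z y)"
    by (rule sum.swap)
  also have "\<dots> = (\<Sum>z\<in>?V. (\<Sum>w\<in>?V. reflection x w * adj G w z) * adj G z y)"
    using adj_reflection[OF x] by (intro sum.cong) (simp_all add: sum_distrib_right[symmetric])
  also have "\<dots> = (\<Sum>z\<in>?V. \<Sum>w\<in>?V. reflection x w * adj G w z * adj G z y)"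
    by (simp add: sum_distrib_right)
  also have "\<dots> = (\<Sum>w\<in>?V. \<Sum>z\<in>?V. reflection x w * adj G w z * adj G z y)"
    by (rule sum.swap)
  also have "\<dots> = (\<Sum>w\<in>?V. reflection x w * of_nat (card (common_nbrs G w y)))"
    by (simp add: card_common_nbrs_eq_sum[OF finite_verts] sum_distrib_left mult.assoc)
  also have "\<dots> = 2 * (\<Sum>z\<in>cell x. of_nat (card (common_nbrs G z y))) / of_nat (card (cell x))
      - of_nat (card (common_nbrs G x y))"
    by (rule sum_reflection_left[OF x])
  finally have "(of_nat (card (cell x) * (card (common_nbrs H x y) + card (common_nbrs G x y))) :: complex)
      = of_nat (2 * (\<Sum>z\<in>cell x. card (common_nbrs G z y)))"
    using card_cell_pos[OF x] by (simp add: field_simps)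
  thus ?thesis unfolding of_nat_eq_iff .
qed

end

subsection \<open>The middle layer\<close>

text \<open>The hypotheses force corresponding regions of the two Venn diagrams in \<open>U\<close>
  to have equal sizes; bijections between the four pairs of regions are glued together.\<close>

lemma ex_bij_betw_pair_images:
  assumes U: "finite U" and sub: "X \<subseteq> U" "Y \<subseteq> U" "X' \<subseteq> U" "Y' \<subseteq> U"
    and cards: "card X = card X'" "card Y = card Y'" "card (X \<inter> Y) = card (X' \<inter> Y')"
  obtains p where "bij_betw p U U" "p ` X = X'" "p ` Y = Y'"
proof -
  have fin: "finite X" "finite Y" "finite X'" "finite Y'" using sub U by (auto intro: finite_subset)
  have "card (X - Y) = card (X' - Y')" "card (Y - X) = card (Y' - X')"
    using cards fin by (simp_all add: card_Diff_subset_Int Int_commute)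
  moreover have "card (X \<union> Y) = card (X' \<union> Y')"
    using cards fin card_Un_Int[of X Y] card_Un_Int[of X' Y'] by simp
  hence "card (U - (X \<union> Y)) = card (U - (X' \<union> Y'))"
    using fin sub by (simp add: card_Diff_subset)
  ultimately obtain f g h l where
    f: "bij_betw f (X \<inter> Y) (X' \<inter> Y')" and g: "bij_betw g (X - Y) (X' - Y')" and
    h: "bij_betw h (Y - X) (Y' - X')" and l: "bij_betw l (U - (X \<union> Y)) (U - (X' \<union> Y'))"
    using cards(3) fin U by (metis finite_Diff finite_Int finite_same_card_bij)
  define p where "p z = (if z \<in> X then if z \<in> Y then f z else g z else if z \<in> Y then h z else l z)" for z
  have im: "p ` (X \<inter> Y) = X' \<inter> Y'" "p ` (X - Y) = X' - Y'" "p ` (Y - X) = Y' - X'"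
    "p ` (U - (X \<union> Y)) = U - (X' \<union> Y')"
    using f g h l by (auto simp: bij_betw_def p_def image_iff)
  have X: "p ` X = X'" using im(1,2) by (metis Int_Diff_Un image_Un)
  have Y: "p ` Y = Y'" using im(1,3) by (metis Int_Diff_Un Int_commute image_Un)
  have "U = X \<union> Y \<union> (U - (X \<union> Y))" using sub by auto
  hence "p ` U = p ` X \<union> p ` Y \<union> p ` (U - (X \<union> Y))" by (metis image_Un)
  hence "p ` U = U" unfolding X Y im(4) using sub by auto
  hence "bij_betw p U U" using U by (simp add: bij_betw_def eq_card_imp_inj_on)
  with X Y show thesis using that by blast
qed

locale middle_layer =
  fixes U :: "'a set" and m :: nat
  assumes finite_U: "finite U" and card_U: "card U = 4 * m + 2" and m_ge: "m \<ge> 2"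
begin

definition V :: "'a set set" where
  "V = {X. X \<subseteq> U \<and> card X = 2 * m + 1}"

definition J :: "'a set pair_pre_digraph" where
  "J = \<lparr> pverts = V,
         parcs = {(X, Y). X \<in> V \<and> Y \<in> V \<and> 1 \<le> card (X \<inter> Y) \<and> card (X \<inter> Y) \<le> m} \<rparr>"

lemma V_D:
  assumes "X \<in> V"
  shows "X \<subseteq> U" "card X = 2 * m + 1" "finite X"
  using assms finite_U by (auto simp: V_def intro: finite_subset)

lemma pverts_J [simp]: "pverts J = V"
  by (simp add: J_def)

lemma parcs_J: "(X, Y) \<in> parcs J \<longleftrightarrow> X \<in> V \<and> Y \<in> V \<and> 1 \<le> card (X \<inter> Y) \<and> card (X \<inter> Y) \<le> m"
  by (simp add: J_def)

lemma finite_V: "finite V"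
  unfolding V_def using finite_U by (auto intro: finite_subset[of _ "Pow U"])

lemma pair_graph_J: "pair_graph J"
  by (rule pair_graphI) (auto simp: finite_V parcs_J V_D(2) Int_commute)

lemma compl_in_V:
  assumes "X \<in> V"
  shows "U - X \<in> V"
  using card_U card_Diff_subset[of X U] V_D[OF assms] by (simp add: V_def)

lemma card_Int_compl:
  assumes "X \<in> V" "Y \<subseteq> U"
  shows "card (X \<inter> (U - Y)) = 2 * m + 1 - card (X \<inter> Y)"
proof -
  have "X \<inter> (U - Y) = X - Y" using V_D[OF assms(1)] by auto
  thus ?thesis using V_D[OF assms(1)] by (simp add: card_Diff_subset_Int)
qed

lemma V_eq_iff:
  assumes "X \<in> V" "Y \<in> V"
  shows "X = Y \<longleftrightarrow> card (X \<inter> Y) = 2 * m + 1"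
proof
  assume *: "card (X \<inter> Y) = 2 * m + 1"
  have "X \<inter> Y = X"
    using V_D[OF assms(1)] * by (intro card_subset_eq) simp_all
  moreover have "X \<inter> Y = Y"
    using V_D[OF assms(2)] * by (intro card_subset_eq) simp_all
  ultimately show "X = Y" by simp
qed (use V_D(2)[OF assms(1)] in simp)

lemma card_Int_le:
  assumes "X \<in> V"
  shows "card (X \<inter> Y) \<le> 2 * m + 1"
  using card_mono[of X "X \<inter> Y"] V_D(2,3)[OF assms] by simp

lemma disjoint_iff_compl:
  assumes "X \<in> V" "Y \<in> V"
  shows "card (X \<inter> Y) = 0 \<longleftrightarrow> Y = U - X"
proof
  assume "card (X \<inter> Y) = 0"
  hence "Y \<subseteq> U - X" using V_D[OF assms(1)] V_D[OF assms(2)] by auto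
  thus "Y = U - X"
    using V_D(2)[OF compl_in_V[OF assms(1)]] V_D(2)[OF assms(2)] finite_U
    by (simp add: card_subset_eq)
qed simp

text \<open>
  Dropping the condition that intersections be nonempty makes the count of common neighbours
  monotone in \<open>card (X \<inter> Y)\<close>.
\<close>

definition far :: "'a set \<Rightarrow> 'a set \<Rightarrow> 'a set set" where
  "far X Y = {Z \<in> V. card (X \<inter> Z) \<le> m \<and> card (Z \<inter> Y) \<le> m}"

lemma finite_far: "finite (far X Y)"
  using finite_V by (simp add: far_def)

text \<open>The far sets that are not common neighbours are disjoint from \<open>X\<close> or from
  \<open>Y\<close>, hence equal to \<open>U - X\<close> or \<open>U - Y\<close>. Both are far
  because \<open>X\<close> and \<open>Y\<close> share more than \<open>m\<close> points.\<close>

lemma card_far_eq: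
  assumes X: "X \<in> V" and Y: "Y \<in> V" and XY: "m + 1 \<le> card (X \<inter> Y)" "X \<noteq> Y"
  shows "card (far X Y) = card (common_nbrs J X Y) + 2"
proof -
  have "card (X \<inter> (U - Y)) \<le> m" "card (Y \<inter> (U - X)) \<le> m"
    using XY card_Int_compl[OF X, of Y] card_Int_compl[OF Y, of X] V_D(1)[OF X] V_D(1)[OF Y]
    by (simp_all add: Int_commute)
  hence far: "U - X \<in> far X Y" "U - Y \<in> far X Y"
    using compl_in_V X Y by (auto simp: far_def Int_commute Int_Diff)
  have "U - X \<noteq> U - Y" using XY V_D(1)[OF X] V_D(1)[OF Y] by blast
  moreover have nin: "U - X \<notin> common_nbrs J X Y" "U - Y \<notin> common_nbrs J X Y"
    using Diff_disjoint[of X U] Diff_disjoint[of Y U]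
    by (simp_all add: common_nbrs_def parcs_J Int_commute)
  moreover have "far X Y = insert (U - X) (insert (U - Y) (common_nbrs J X Y))"
  proof (rule equalityI)
    show "far X Y \<subseteq> insert (U - X) (insert (U - Y) (common_nbrs J X Y))"
    proof
      fix Z assume Z: "Z \<in> far X Y"
      hence "Z \<in> V" by (simp add: far_def)
      thus "Z \<in> insert (U - X) (insert (U - Y) (common_nbrs J X Y))"
        using Z X Y disjoint_iff_compl[OF X, of Z] disjoint_iff_compl[OF Y, of Z]
        by (simp add: far_def common_nbrs_def parcs_J Int_commute) linarith
    qed
    have "common_nbrs J X Y \<subseteq> far X Y" by (auto simp: common_nbrs_def parcs_J far_def)
    thus "insert (U - X) (insert (U - Y) (common_nbrs J X Y)) \<subseteq> far X Y"
      using far by simp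
  qed
  moreover have "finite (common_nbrs J X Y)" by (simp add: common_nbrs_def finite_V)
  ultimately show ?thesis by simp
qed

text \<open>A permutation of \<open>U\<close> taking \<open>(X, Y)\<close> to
  \<open>(X', Y')\<close> maps far sets injectively to far sets. Exchanging the two pairs then gives
  equality.\<close>

lemma card_far_le:
  assumes X: "X \<in> V" and Y: "Y \<in> V" and X': "X' \<in> V" and Y': "Y' \<in> V"
    and eq: "card (X \<inter> Y) = card (X' \<inter> Y')"
  shows "card (far X Y) \<le> card (far X' Y')"
proof -
  obtain p where p: "bij_betw p U U" "p ` X = X'" "p ` Y = Y'"
    using ex_bij_betw_pair_images[OF finite_U, of X Y X' Y'] V_D X Y X' Y' eq by metis
  hence inj: "inj_on p U" and im: "p ` U = U" by (auto simp: bij_betw_def)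
  have card_p: "card (p ` A \<inter> p ` B) = card (A \<inter> B)" if "A \<subseteq> U" "B \<subseteq> U" for A B
  proof -
    have "p ` A \<inter> p ` B = p ` (A \<inter> B)" using inj_on_image_Int[OF inj that] by simp
    thus ?thesis using inj that by (metis card_image inf.coboundedI1 inj_on_subset)
  qed
  show ?thesis
  proof (rule card_inj_on_le[of "image p"])
    show "inj_on (image p) (far X Y)"
      using inj_on_image_Pow[OF inj] by (rule inj_on_subset) (auto simp: far_def V_def)
    show "image p ` far X Y \<subseteq> far X' Y'"
    proof
      fix W assume "W \<in> image p ` far X Y"
      then obtain Z where W: "W = p ` Z" and Z: "Z \<in> V" "card (X \<inter> Z) \<le> m" "card (Z \<inter> Y) \<le> m"
        by (auto simp: far_def)
      have "W \<in> V" using Z(1) inj im unfolding W V_def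
        by (auto simp: card_image inj_on_subset)
      moreover have "card (X' \<inter> W) \<le> m" "card (W \<inter> Y') \<le> m"
        using Z card_p V_D(1)[OF X] V_D(1)[OF Y] V_D(1)[OF Z(1)] unfolding W p(2,3)[symmetric]
        by simp_all
      ultimately show "W \<in> far X' Y'" by (simp add: far_def)
    qed
  qed (rule finite_far)
qed

lemma card_far_cong:
  assumes "X \<in> V" "Y \<in> V" "X' \<in> V" "Y' \<in> V" "card (X \<inter> Y) = card (X' \<inter> Y')"
  shows "card (far X Y) = card (far X' Y')"
  using assms by (intro antisym card_far_le) simp_all

lemma card_exchange:
  assumes "finite Z" "a \<in> Z" "b \<notin> Z"
  shows "card (insert b (Z - {a})) = card Z"
  using assms by (metis Diff_iff card_Suc_Diff1 card_insert_disjoint finite_Diff)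

lemma exchange_in_V:
  assumes "Z \<in> V" "a \<in> Z" "b \<in> U" "b \<notin> Z"
  shows "insert b (Z - {a}) \<in> V"
  using assms card_exchange[of Z a b] V_D[OF assms(1)] unfolding V_def by auto

text \<open>
  The sets that are lost when \<open>b\<close> is replaced by \<open>a\<close> in \<open>Y\<close> are mapped injectively to gained ones by
  exchanging \<open>a\<close> and \<open>b\<close>; some gained set is not hit.
\<close>

lemma card_far_exchange_less:
  assumes X: "X \<in> V" and Y: "Y \<in> V" and a: "a \<in> X" "a \<notin> Y" and b: "b \<in> Y" "b \<notin> X"
    and XY: "m \<le> card (X \<inter> Y)"
  shows "card (far X Y) < card (far X (insert a (Y - {b})))"
proof -
  define Y' where "Y' = insert a (Y - {b})"
  have ab: "a \<in> U" "b \<in> U" "a \<noteq> b" using a b V_D(1)[OF X] V_D(1)[OF Y] by auto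
  define s where "s Z = (if card (Z \<inter> Y') \<le> m then Z else insert b (Z - {a}))" for Z
  \<comment> \<open>A lost set contains \<open>a\<close> but not \<open>b\<close>, and the exchange
    swaps the sizes of its intersections with \<open>Y\<close> and \<open>Y'\<close> without
    enlarging the one with \<open>X\<close>. The result is outside \<open>far X Y\<close>, so it
    cannot collide with a set that \<open>s\<close> leaves fixed.\<close>
  have lost: "a \<in> Z \<and> b \<notin> Z \<and> insert b (Z - {a}) \<in> far X Y' \<and> insert b (Z - {a}) \<notin> far X Y"
    if Z: "Z \<in> far X Y" and gt: "\<not> card (Z \<inter> Y') \<le> m" for Z
  proof -
    have ZV: "Z \<in> V" and le: "card (X \<inter> Z) \<le> m" "card (Z \<inter> Y) \<le> m" using Z by (auto simp: far_def)
    note fin = V_D(3)[OF ZV]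
    have aZ: "a \<in> Z"
    proof (rule ccontr)
      assume "a \<notin> Z"
      hence "card (Z \<inter> Y') \<le> card (Z \<inter> Y)" using fin by (intro card_mono) (auto simp: Y'_def)
      with le gt show False by simp
    qed
    have bZ: "b \<notin> Z"
    proof
      assume "b \<in> Z"
      hence "Z \<inter> Y' = insert a ((Z \<inter> Y) - {b})" using aZ by (auto simp: Y'_def)
      hence "card (Z \<inter> Y') = card (Z \<inter> Y)"
        using card_exchange[of "Z \<inter> Y" b a] fin a b \<open>b \<in> Z\<close> by auto
      with le gt show False by simp
    qed
    let ?W = "insert b (Z - {a})"
    have W: "?W \<in> V" using ZV aZ ab(2) bZ by (rule exchange_in_V)
    have "X \<inter> ?W \<subseteq> X \<inter> Z" using b by auto
    hence "card (X \<inter> ?W) \<le> card (X \<inter> Z)" using fin by (intro card_mono) auto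
    moreover have "?W \<inter> Y' = Z \<inter> Y" using a b ab aZ bZ by (auto simp: Y'_def)
    moreover have "Z \<inter> Y' = insert a (Z \<inter> Y)" "?W \<inter> Y = insert b (Z \<inter> Y)"
      using a b aZ bZ by (auto simp: Y'_def)
    hence "card (?W \<inter> Y) = card (Z \<inter> Y')" using fin a bZ by simp
    ultimately show ?thesis using aZ bZ W le gt by (auto simp: far_def)
  qed
  have s_far: "s Z \<in> far X Y'" if "Z \<in> far X Y" for Z
  proof (cases "card (Z \<inter> Y') \<le> m")
    case True
    thus ?thesis using that by (simp add: s_def far_def)
  next
    case False
    thus ?thesis using lost[OF that] by (simp add: s_def)
  qed
  have inj: "inj_on s (far X Y)"
  proof (rule inj_onI)
    fix Z W assume ZW: "Z \<in> far X Y" "W \<in> far X Y" "s Z = s W"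
    consider "card (Z \<inter> Y') \<le> m" "card (W \<inter> Y') \<le> m"
      | "card (Z \<inter> Y') \<le> m" "\<not> card (W \<inter> Y') \<le> m"
      | "\<not> card (Z \<inter> Y') \<le> m" "card (W \<inter> Y') \<le> m"
      | "\<not> card (Z \<inter> Y') \<le> m" "\<not> card (W \<inter> Y') \<le> m" by blast
    thus "Z = W"
    proof cases
      case 2
      thus ?thesis using lost[OF ZW(2)] ZW by (metis s_def)
    next
      case 3
      thus ?thesis using lost[OF ZW(1)] ZW by (metis s_def)
    next
      case gt: 4
      hence "insert b (Z - {a}) = insert b (W - {a})" using ZW by (simp add: s_def)
      moreover have "Z = insert a (insert b (Z - {a}) - {b})" "W = insert a (insert b (W - {a}) - {b})"
        using lost[OF ZW(1) gt(1)] lost[OF ZW(2) gt(2)] by auto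
      ultimately show ?thesis by simp
    qed (use ZW in \<open>simp add: s_def\<close>)
  qed
  \<comment> \<open>The missed set consists of \<open>b\<close>, \<open>m\<close> points of
    \<open>X \<inter> Y\<close> and \<open>m\<close> points outside \<open>X \<union> Y\<close>. The
    latter exist because \<open>U - (X \<union> Y)\<close> is as large as
    \<open>X \<inter> Y\<close>.\<close>
  obtain P where P: "P \<subseteq> X \<inter> Y" "card P = m" "finite P"
    using XY by (rule obtain_subset_with_card_n)
  have "card (X \<union> Y) + card (X \<inter> Y) = 4 * m + 2"
    using card_Un_Int[OF V_D(3)[OF X] V_D(3)[OF Y]] V_D(2)[OF X] V_D(2)[OF Y] by simp
  hence "m \<le> card (U - (X \<union> Y))"
    using XY V_D[OF X] V_D[OF Y] by (simp add: card_Diff_subset card_U)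
  then obtain R where R: "R \<subseteq> U - (X \<union> Y)" "card R = m" "finite R"
    by (rule obtain_subset_with_card_n)
  let ?W = "insert b (P \<union> R)"
  have "P \<inter> R = {}" "b \<notin> P \<union> R" using P R b by auto
  hence "card ?W = 2 * m + 1" using P R by (simp add: card_Un_disjoint)
  moreover have "?W \<subseteq> U" using P R ab V_D(1)[OF X] by auto
  ultimately have WV: "?W \<in> V" by (simp add: V_def)
  have "X \<inter> ?W = P" "?W \<inter> Y' = P" "?W \<inter> Y = insert b P"
    using P R a b ab V_D(1)[OF X] by (auto simp: Y'_def)
  hence Wcard: "card (X \<inter> ?W) = m" "card (?W \<inter> Y') = m" "card (?W \<inter> Y) = m + 1"
    using P \<open>b \<notin> P \<union> R\<close> by auto
  have W: "?W \<in> far X Y'" "?W \<notin> far X Y" using WV Wcard by (auto simp: far_def)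
  have "?W \<notin> s ` far X Y"
  proof
    assume "?W \<in> s ` far X Y"
    then obtain Z where Z: "Z \<in> far X Y" "s Z = ?W" by auto
    hence gt: "\<not> card (Z \<inter> Y') \<le> m" using W(2) by (auto simp: s_def)
    note l = lost[OF Z(1) gt]
    have eq: "insert b (Z - {a}) = ?W" using Z gt by (simp add: s_def)
    \<comment> \<open>A preimage would contain \<open>a\<close> besides the \<open>m\<close> points
      of \<open>P\<close>, and so would meet \<open>X\<close> in too many points.\<close>
    have "X \<inter> Z = insert a (X \<inter> insert b (Z - {a}))" using l a b by auto
    also have "\<dots> = insert a (X \<inter> ?W)" by (simp only: eq)
    finally have "X \<inter> Z = insert a (X \<inter> ?W)" .
    moreover have "a \<notin> ?W" using a P R ab V_D(1)[OF X] by auto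
    ultimately have "card (X \<inter> Z) = m + 1" using Wcard(1) V_D(3)[OF X] by simp
    thus False using Z(1) by (simp add: far_def)
  qed
  hence "s ` far X Y \<subset> far X Y'" using s_far W(1) by blast
  thus ?thesis
    using psubset_card_mono[OF finite_far] card_image[OF inj] unfolding Y'_def by metis
qed

text \<open>Only the sizes of the intersections matter, so \<open>Y\<close> is moved towards
  \<open>X\<close> one exchange at a time until the larger size is reached; each exchange gains
  strictly.\<close>

lemma card_far_less:
  assumes "X \<in> V" "Y \<in> V" "X' \<in> V" "Y' \<in> V"
    and "m \<le> card (X \<inter> Y)" "card (X \<inter> Y) < card (X' \<inter> Y')"
  shows "card (far X Y) < card (far X' Y')"
  using assms
proof (induction "card (X' \<inter> Y') - card (X \<inter> Y)" arbitrary: Y rule: less_induct)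
  case less
  note X = less.prems(1) and Y = less.prems(2)
  have neq: "X \<noteq> Y"
    using less.prems card_Int_le[of X' Y'] V_eq_iff[of X Y] by auto
  obtain a where a: "a \<in> X" "a \<notin> Y"
    using neq V_D[OF X] V_D[OF Y] by (metis card_subset_eq subsetI)
  obtain b where b: "b \<in> Y" "b \<notin> X"
    using neq V_D[OF X] V_D[OF Y] by (metis card_subset_eq subsetI)
  let ?Y = "insert a (Y - {b})"
  have Y'': "?Y \<in> V" using Y b(1) _ a(2) by (rule exchange_in_V) (use V_D(1)[OF X] a in auto)
  have lt: "card (far X Y) < card (far X ?Y)"
    by (rule card_far_exchange_less) (use a b less.prems in auto)
  have "X \<inter> ?Y = insert a (X \<inter> Y)" using a b by auto
  hence c: "card (X \<inter> ?Y) = card (X \<inter> Y) + 1" using a V_D(3)[OF X] by simp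
  show ?case
  proof (cases "card (X \<inter> ?Y) = card (X' \<inter> Y')")
    case True
    thus ?thesis using card_far_cong[OF X Y'' less.prems(3,4)] lt by simp
  next
    case False
    hence "card (far X ?Y) < card (far X' Y')"
      using less.prems X Y'' c by (intro less.hyps) auto
    with lt show ?thesis by simp
  qed
qed

text \<open>A common neighbour would have at most \<open>m\<close> points in \<open>X\<close> and at
  most \<open>m\<close> outside, but it has \<open>2 * m + 1\<close>.\<close>

lemma common_nbrs_compl:
  assumes "X \<in> V"
  shows "common_nbrs J X (U - X) = {}"
proof (rule equals0I)
  fix Z assume "Z \<in> common_nbrs J X (U - X)"
  hence "Z \<in> V" "card (Z \<inter> X) \<le> m" "card (Z \<inter> (U - X)) \<le> m"
    by (auto simp: common_nbrs_def parcs_J Int_commute)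
  thus False using card_Int_compl[of Z X] V_D(1)[OF assms] by linarith
qed

end

subsection \<open>The switched graph\<close>

locale switched_middle_layer = middle_layer +
  fixes T :: "'a set"
  assumes T_sub: "T \<subseteq> U" and card_T: "card T = 2 * m + 2"
begin

definition level :: "'a set \<Rightarrow> nat" where
  "level X = card (X \<inter> T)"

text \<open>
  The switching sets are \<open>{X \<in> V. level X = 2 * m + 1}\<close>, consisting of the sets \<open>T - {t}\<close>, and
  \<open>{X \<in> V. level X = 1}\<close>, consisting of their complements.
\<close>

definition special :: "'a set \<Rightarrow> bool" where
  "special X \<longleftrightarrow> level X = 1 \<or> level X = 2 * m + 1"

definition flip :: "'a set \<Rightarrow> 'a set \<Rightarrow> bool" where
  "flip X Y \<longleftrightarrow> level X = m + 1 \<and> special Y \<or> level Y = m + 1 \<and> special X"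

definition K :: "'a set pair_pre_digraph" where
  "K = \<lparr> pverts = V, parcs = {(X, Y). X \<in> V \<and> Y \<in> V \<and> ((X, Y) \<in> parcs J) \<noteq> flip X Y} \<rparr>"

definition cell :: "'a set \<Rightarrow> 'a set set" where
  "cell X = (if special X then {Y \<in> V. level Y = level X} else {X})"

lemma finite_T: "finite T"
  using T_sub finite_U by (rule finite_subset)

lemma pverts_K [simp]: "pverts K = V"
  by (simp add: K_def)

lemma pair_graph_K: "pair_graph K"
proof (rule pair_graphI)
  fix X Y assume XY: "(X, Y) \<in> parcs K"
  moreover have "X \<noteq> Y"
    \<comment> \<open>Switching creates no loops: level \<open>m + 1\<close> is not a special
      level.\<close>
    using XY m_ge V_D(2)[of X] by (auto simp: K_def parcs_J flip_def special_def)
  ultimately show "X \<in> pverts K \<and> Y \<in> pverts K \<and> X \<noteq> Y \<and> (Y, X) \<in> parcs K"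
    by (auto simp: K_def parcs_J flip_def Int_commute)
qed (simp add: finite_V)

lemma T_diff_in_V: "t \<in> T \<Longrightarrow> T - {t} \<in> V"
  using T_sub card_T finite_T by (auto simp: V_def)

lemma card_Int_T_diff: "card (X \<inter> (T - {t})) = level X - of_bool (t \<in> X)" if "t \<in> T"
proof -
  have "X \<inter> (T - {t}) = (X \<inter> T) - {t}" by auto
  thus ?thesis using that finite_T by (simp add: level_def)
qed

lemma level_compl: "level (U - X) = 2 * m + 2 - level X"
proof -
  have "(U - X) \<inter> T = T - X \<inter> T" using T_sub by auto
  thus ?thesis using finite_T by (simp add: level_def card_Diff_subset_Int card_T Int_ac)
qed

text \<open>\<open>T\<close> has one point too many to fit into a member of \<open>V\<close> or into
  the complement of one.\<close>

lemma level_bounds: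
  assumes "X \<in> V"
  shows "1 \<le> level X" "level X \<le> 2 * m + 1"
proof -
  show "level X \<le> 2 * m + 1" using card_Int_le[OF assms] by (simp add: level_def)
  have "level (U - X) \<le> 2 * m + 1"
    using card_Int_le[OF compl_in_V[OF assms]] by (simp add: level_def)
  thus "1 \<le> level X" unfolding level_compl by linarith
qed

lemma level_top: "{X \<in> V. level X = 2 * m + 1} = (\<lambda>t. T - {t}) ` T"
proof (rule equalityI; rule subsetI)
  fix X assume "X \<in> {X \<in> V. level X = 2 * m + 1}"
  hence X: "X \<in> V" "card (X \<inter> T) = 2 * m + 1" by (auto simp: level_def)
  have "X \<inter> T = X" using V_D[OF X(1)] X(2) by (intro card_subset_eq) auto
  hence XT: "X \<subseteq> T" by auto
  hence "card (T - X) = 1"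
    using V_D[OF X(1)] card_T by (simp add: card_Diff_subset)
  then obtain t where "T - X = {t}" by (auto simp: card_1_singleton_iff)
  hence "t \<in> T" "X = T - {t}" using XT by auto
  thus "X \<in> (\<lambda>t. T - {t}) ` T" by auto
next
  fix X assume "X \<in> (\<lambda>t. T - {t}) ` T"
  then obtain t where t: "t \<in> T" "X = T - {t}" by auto
  have "level X = 2 * m + 1"
    using t finite_T card_T by (simp add: level_def Int_absorb2 Diff_subset)
  thus "X \<in> {X \<in> V. level X = 2 * m + 1}" using t T_diff_in_V by simp
qed

lemma level_bottom: "{X \<in> V. level X = 1} = (\<lambda>t. U - (T - {t})) ` T"
proof -
  have "{X \<in> V. level X = 1} = (\<lambda>X. U - X) ` {X \<in> V. level X = 2 * m + 1}"
  proof (rule equalityI; rule subsetI)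
    fix X assume "X \<in> {X \<in> V. level X = 1}"
    hence "U - X \<in> {X \<in> V. level X = 2 * m + 1}" "X = U - (U - X)"
      using compl_in_V[of X] V_D(1)[of X] by (auto simp: level_compl)
    thus "X \<in> (\<lambda>X. U - X) ` {X \<in> V. level X = 2 * m + 1}" by blast
  next
    fix X assume "X \<in> (\<lambda>X. U - X) ` {X \<in> V. level X = 2 * m + 1}"
    thus "X \<in> {X \<in> V. level X = 1}" using compl_in_V by (auto simp: level_compl)
  qed
  thus ?thesis by (simp only: level_top image_image)
qed

lemma inj_on_T_diff: "inj_on (\<lambda>t. T - {t}) T" "inj_on (\<lambda>t. U - (T - {t})) T"
  using T_sub by (auto intro!: inj_onI)

section \<open>Adjacency between vertices and the switching sets\<close>

lemma adj_T_diff: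
  assumes "X \<in> V" "t \<in> T"
  shows "(X, T - {t}) \<in> parcs J \<longleftrightarrow> 1 \<le> level X - of_bool (t \<in> X) \<and> level X - of_bool (t \<in> X) \<le> m"
  using assms T_diff_in_V by (simp add: parcs_J card_Int_T_diff)

lemma adj_compl_T_diff:
  assumes "X \<in> V" "t \<in> T"
  shows "(X, U - (T - {t})) \<in> parcs J \<longleftrightarrow>
    m + 1 \<le> level X - of_bool (t \<in> X) \<and> level X - of_bool (t \<in> X) \<le> 2 * m"
proof -
  have "card (X \<inter> (U - (T - {t}))) = 2 * m + 1 - (level X - of_bool (t \<in> X))"
    using card_Int_compl[of X "T - {t}", OF assms(1)] V_D(1)[OF T_diff_in_V[OF assms(2)]]
      card_Int_T_diff[OF assms(2), of X] by simp
  thus ?thesis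
    using assms T_diff_in_V compl_in_V level_bounds[OF assms(1)] by (simp add: parcs_J) linarith
qed

text \<open>Parametrises either switching set by the points of \<open>T\<close>, so that sums over
  it become counts of points inside or outside a given vertex.\<close>

lemma sum_special_cell:
  assumes "special Y"
  obtains c where "\<And>g :: 'a set \<Rightarrow> complex. (\<Sum>Z\<in>cell Y. g Z) = (\<Sum>t\<in>T. g (c t))" "cell Y = c ` T"
    "level Y = 2 * m + 1 \<and> c = (\<lambda>t. T - {t}) \<or> level Y = 1 \<and> c = (\<lambda>t. U - (T - {t}))"
proof (cases "level Y = 2 * m + 1")
  case True
  hence "cell Y = (\<lambda>t. T - {t}) ` T" using assms level_top by (simp add: cell_def)
  thus thesis using True that[of "\<lambda>t. T - {t}"] by (simp add: sum.reindex inj_on_T_diff)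
next
  case False
  hence "level Y = 1" using assms by (simp add: special_def)
  moreover from this have "cell Y = (\<lambda>t. U - (T - {t})) ` T"
    using assms level_bottom by (simp add: cell_def)
  ultimately show thesis
    using that[of "\<lambda>t. U - (T - {t})"] by (simp add: sum.reindex inj_on_T_diff)
qed

lemma card_special_cell:
  assumes "special X"
  shows "card (cell X) = 2 * m + 2"
proof -
  obtain c where "cell X = c ` T" "c = (\<lambda>t. T - {t}) \<or> c = (\<lambda>t. U - (T - {t}))"
    using sum_special_cell[OF assms] by metis
  thus ?thesis using inj_on_T_diff by (auto simp: card_image card_T)
qed

lemma card_T_outside: "card (T \<inter> {t. t \<notin> X}) = 2 * m + 2 - level X"
proof -
  have "T \<inter> {t. t \<notin> X} = T - X \<inter> T" by auto
  thus ?thesis using finite_T by (simp add: level_def card_Diff_subset_Int card_T Int_ac)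
qed

lemma card_T_inside: "card (T \<inter> X) = level X"
  by (simp add: level_def Int_commute)

text \<open>At level \<open>m + 1\<close>, removing \<open>t\<close> decides on which side of the
  threshold \<open>m\<close> the intersection falls: \<open>X\<close> is adjacent to
  \<open>T - {t}\<close> exactly if \<open>t \<in> X\<close>, and to its complement exactly if
  \<open>t \<notin> X\<close>. Each case has \<open>m + 1\<close> points.\<close>

lemma sum_adj_special_cell_half:
  assumes X: "X \<in> V" "level X = m + 1" and Y: "special Y"
  shows "(\<Sum>Z\<in>cell Y. adj J X Z) = of_nat (m + 1)"
proof -
  obtain c where sum: "\<And>g :: 'a set \<Rightarrow> complex. (\<Sum>Z\<in>cell Y. g Z) = (\<Sum>t\<in>T. g (c t))"
    and c: "c = (\<lambda>t. T - {t}) \<or> c = (\<lambda>t. U - (T - {t}))"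
    using sum_special_cell[OF Y] by metis
  from c show ?thesis
  proof
    assume c: "c = (\<lambda>t. T - {t})"
    have "(\<Sum>Z\<in>cell Y. adj J X Z) = (\<Sum>t\<in>T. of_bool (t \<in> X))"
      unfolding sum c using X m_ge by (intro sum.cong) (auto simp: adj_def adj_T_diff)
    thus ?thesis using X by (simp add: finite_T card_T_inside)
  next
    assume c: "c = (\<lambda>t. U - (T - {t}))"
    have "(\<Sum>Z\<in>cell Y. adj J X Z) = (\<Sum>t\<in>T. of_bool (t \<notin> X))"
      unfolding sum c using X m_ge by (intro sum.cong) (auto simp: adj_def adj_compl_T_diff)
    thus ?thesis using X by (simp add: finite_T card_T_outside)
  qed
qed

text \<open>At the remaining levels the removal of one point neither crosses the threshold
  \<open>m\<close> nor makes an intersection empty.\<close>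

lemma adj_special_cell_const:
  assumes X: "X \<in> V" "level X \<noteq> m + 1" "\<not> special X" and Y: "special Y" and Z: "Z \<in> cell Y" "W \<in> cell Y"
  shows "adj J X Z = adj J X W"
proof -
  obtain c where cell: "cell Y = c ` T" and c: "c = (\<lambda>t. T - {t}) \<or> c = (\<lambda>t. U - (T - {t}))"
    using sum_special_cell[OF Y] by metis
  have l: "2 \<le> level X" "level X \<le> 2 * m" "level X \<le> m \<or> m + 2 \<le> level X"
    using X level_bounds[OF X(1)] by (auto simp: special_def)
  have "\<exists>v. \<forall>t\<in>T. adj J X (c t) = v"
    using c
  proof
    assume c: "c = (\<lambda>t. T - {t})"
    have "adj J X (c t) = of_bool (level X \<le> m)" if "t \<in> T" for t
      using that X(1) l unfolding c by (cases "t \<in> X") (auto simp: adj_def adj_T_diff)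
    thus ?thesis by blast
  next
    assume c: "c = (\<lambda>t. U - (T - {t}))"
    have "adj J X (c t) = of_bool (m + 2 \<le> level X)" if "t \<in> T" for t
      using that X(1) l unfolding c by (cases "t \<in> X") (auto simp: adj_def adj_compl_T_diff)
    thus ?thesis by blast
  qed
  with Z show ?thesis unfolding cell by auto
qed

text \<open>Sets in the same switching set meet in at least \<open>2 * m\<close> points. Across the
  two sets, \<open>T - {s}\<close> and \<open>U - (T - {t})\<close> share only \<open>t\<close>, or
  nothing if \<open>s = t\<close>, so just one pair per vertex is missing.\<close>

lemma sum_adj_special_special:
  assumes X: "X \<in> V" "special X" and Y: "special Y"
  shows "(\<Sum>Z\<in>cell Y. adj J X Z) = (if level X = level Y then 0 else of_nat (2 * m + 1))"
proof -
  obtain c where sum: "\<And>g :: 'a set \<Rightarrow> complex. (\<Sum>Z\<in>cell Y. g Z) = (\<Sum>t\<in>T. g (c t))"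
    and c: "level Y = 2 * m + 1 \<and> c = (\<lambda>t. T - {t}) \<or> level Y = 1 \<and> c = (\<lambda>t. U - (T - {t}))"
    using sum_special_cell[OF Y] by metis
  from c show ?thesis
  proof (elim disjE conjE)
    assume Y: "level Y = 2 * m + 1" and c: "c = (\<lambda>t. T - {t})"
    have "(\<Sum>Z\<in>cell Y. adj J X Z) = (\<Sum>t\<in>T. of_bool (level X = 1 \<and> t \<notin> X))"
      unfolding sum c using X m_ge by (intro sum.cong) (auto simp: adj_def adj_T_diff special_def)
    thus ?thesis using X(2) Y m_ge
      by (cases "level X = 1") (auto simp: finite_T card_T_outside special_def)
  next
    assume Y: "level Y = 1" and c: "c = (\<lambda>t. U - (T - {t}))"
    have "(\<Sum>Z\<in>cell Y. adj J X Z) = (\<Sum>t\<in>T. of_bool (level X = 2 * m + 1 \<and> t \<in> X))"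
      unfolding sum c using X m_ge
      by (intro sum.cong) (auto simp: adj_def adj_compl_T_diff special_def)
    thus ?thesis using X(2) Y m_ge
      by (cases "level X = 1") (auto simp: finite_T card_T_inside special_def)
  qed
qed

lemma adj_J_sym: "adj J X Y = adj J Y X"
  by (auto simp: adj_def parcs_J Int_commute)

lemma adj_K: "X \<in> V \<Longrightarrow> Y \<in> V \<Longrightarrow> adj K X Y = (if flip X Y then 1 - adj J X Y else adj J X Y)"
  by (auto simp: adj_def K_def)

lemma adj_K_sym: "X \<in> V \<Longrightarrow> Y \<in> V \<Longrightarrow> adj K X Y = adj K Y X"
  using adj_J_sym by (auto simp: adj_K flip_def)

lemma cell_sub: "X \<in> V \<Longrightarrow> cell X \<subseteq> V"
  by (auto simp: cell_def)

lemma cell_eq: "Y \<in> cell X \<Longrightarrow> cell Y = cell X"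
  by (auto simp: cell_def special_def)

text \<open>At level \<open>m + 1\<close> the two entries add up to 1, twice the average 1/2 over
  the cell. Elsewhere the row is constant on the cell and unchanged. Toggling a half-filled row
  preserves its sum.\<close>

lemma adj_K_add_adj_J:
  assumes X: "X \<in> V" "\<not> special X" and Y: "Y \<in> V" "special Y"
  shows "adj K X Y + adj J X Y = 2 * (\<Sum>Z\<in>cell Y. adj J X Z) / of_nat (2 * m + 2)"
    and "(\<Sum>Z\<in>cell Y. adj K X Z) = (\<Sum>Z\<in>cell Y. adj J X Z)"
proof -
  have special: "special Z" "Z \<in> V" if "Z \<in> cell Y" for Z
    using that Y(2) by (auto simp: cell_def special_def)
  have nz: "(of_nat (2 * m + 2) :: complex) \<noteq> 0" by (simp only: of_nat_eq_0_iff)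
  have "adj K X Y + adj J X Y = 2 * (\<Sum>Z\<in>cell Y. adj J X Z) / of_nat (2 * m + 2) \<and>
    (\<Sum>Z\<in>cell Y. adj K X Z) = (\<Sum>Z\<in>cell Y. adj J X Z)"
  proof (cases "level X = m + 1")
    case True
    have K: "adj K X Z = 1 - adj J X Z" if "Z \<in> V" "special Z" for Z
      using X(1) that True by (simp add: adj_K flip_def)
    have "(\<Sum>Z\<in>cell Y. adj K X Z) = (\<Sum>Z\<in>cell Y. 1 - adj J X Z)"
      using K special by (intro sum.cong) auto
    also have "\<dots> = of_nat (2 * m + 2) - of_nat (m + 1)"
      using sum_adj_special_cell_half[OF X(1) True Y(2)] card_special_cell[OF Y(2)]
      by (simp add: sum_subtractf)
    finally show ?thesis
      using sum_adj_special_cell_half[OF X(1) True Y(2)] K[OF Y] nz by (simp add: field_simps)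
  next
    case False
    have K: "adj K X Z = adj J X Z" if "Z \<in> V" for Z
      using X that False by (simp add: adj_K flip_def)
    have "Y \<in> cell Y" using Y by (simp add: cell_def)
    hence "(\<Sum>Z\<in>cell Y. adj J X Z) = (\<Sum>Z\<in>cell Y. adj J X Y)"
      by (intro sum.cong refl adj_special_cell_const[OF X(1) False X(2) Y(2)])
    hence "(\<Sum>Z\<in>cell Y. adj J X Z) = of_nat (2 * m + 2) * adj J X Y"
      using card_special_cell[OF Y(2)] by simp
    moreover have "(\<Sum>Z\<in>cell Y. adj K X Z) = (\<Sum>Z\<in>cell Y. adj J X Z)"
      using K special by (intro sum.cong) auto
    ultimately show ?thesis using K[OF Y(1)] nz by (simp add: field_simps)
  qed
  thus "adj K X Y + adj J X Y = 2 * (\<Sum>Z\<in>cell Y. adj J X Z) / of_nat (2 * m + 2)"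
    "(\<Sum>Z\<in>cell Y. adj K X Z) = (\<Sum>Z\<in>cell Y. adj J X Z)" by auto
qed

sublocale gm_switching J K cell
proof
  fix X Y assume "X \<in> pverts J" "Y \<in> pverts J"
  hence X: "X \<in> V" and Y: "Y \<in> V" by simp_all
  have sym: "(\<Sum>Z\<in>cell X. adj J Z Y) = (\<Sum>Z\<in>cell X. adj J Y Z)"
    by (intro sum.cong refl adj_J_sym)
  have single: "cell Z = {Z}" if "\<not> special Z" for Z using that by (simp add: cell_def)
  show "adj K X Y - adj J X Y = 2 * ((\<Sum>Z\<in>cell Y. adj K X Z) / of_nat (card (cell Y))
      - (\<Sum>Z\<in>cell X. adj J Z Y) / of_nat (card (cell X)))"
  \<comment> \<open>If both are special, nothing is toggled and the two averages agree. If one is,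
    the claim rearranges \<open>adj_K_add_adj_J\<close>. If neither is, both cells are
    singletons.\<close>
  proof (cases "special X"; cases "special Y")
    assume s: "special X" "special Y"
    have "\<not> flip X Z" if "Z \<in> cell Y" for Z
      using s that m_ge by (auto simp: flip_def cell_def special_def)
    hence K: "adj K X Z = adj J X Z" if "Z \<in> cell Y" for Z
      using adj_K[OF X] cell_sub[OF Y] that by auto
    hence "(\<Sum>Z\<in>cell Y. adj K X Z) = (\<Sum>Z\<in>cell Y. adj J X Z)" by (rule sum.cong[OF refl])
    moreover have "adj K X Y = adj J X Y" using K Y s by (simp add: cell_def)
    ultimately show ?thesis
      using s X Y by (simp add: sym sum_adj_special_special card_special_cell)
  next
    assume s: "special X" "\<not> special Y"
    have "adj K X Y + adj J X Y = 2 * (\<Sum>Z\<in>cell X. adj J Y Z) / of_nat (card (cell X))"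
      using adj_K_add_adj_J(1)[OF Y s(2) X s(1)] X Y s adj_K_sym[OF X Y] adj_J_sym[of X Y]
      by (simp only: card_special_cell)
    thus ?thesis unfolding sym using single[OF s(2)] by (simp add: algebra_simps)
  next
    assume s: "\<not> special X" "special Y"
    have "adj K X Y + adj J X Y = 2 * (\<Sum>Z\<in>cell Y. adj J X Z) / of_nat (card (cell Y))"
      using adj_K_add_adj_J(1)[OF X s(1) Y s(2)] s by (simp only: card_special_cell)
    thus ?thesis
      using single[OF s(1)] adj_K_add_adj_J(2)[OF X s(1) Y s(2)] by (simp add: algebra_simps)
  next
    assume s: "\<not> special X" "\<not> special Y"
    hence "\<not> flip X Y" by (simp add: flip_def)
    thus ?thesis using s by (simp add: single adj_K[OF X Y])
  qed
qed (use cell_sub cell_eq in \<open>auto simp: finite_V cell_def\<close>)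

end

section \<open>Non-isomorphism of the switched graph\<close>

context middle_layer
begin

text \<open>In this range of intersection sizes \<open>far\<close> counts exactly two more sets than
  \<open>common_nbrs\<close>, so its behaviour carries over, here and in
  \<open>common_nbrs_less\<close>.\<close>

lemma common_nbrs_cong:
  assumes V: "X \<in> V" "Y \<in> V" "X' \<in> V" "Y' \<in> V"
    and i: "card (X \<inter> Y) = card (X' \<inter> Y')" "m + 1 \<le> card (X \<inter> Y)" "card (X \<inter> Y) \<le> 2 * m"
  shows "card (common_nbrs J X Y) = card (common_nbrs J X' Y')"
proof -
  have "X \<noteq> Y" "X' \<noteq> Y'" using V i V_eq_iff by auto
  thus ?thesis using card_far_eq[OF V(1,2)] card_far_eq[OF V(3,4)] card_far_cong[OF V] i by simp
qed

lemma common_nbrs_less: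
  assumes V: "X \<in> V" "Y \<in> V" "X' \<in> V" "Y' \<in> V"
    and i: "m + 1 \<le> card (X \<inter> Y)" "card (X \<inter> Y) < card (X' \<inter> Y')" "card (X' \<inter> Y') \<le> 2 * m"
  shows "card (common_nbrs J X Y) < card (common_nbrs J X' Y')"
proof -
  have "X \<noteq> Y" "X' \<noteq> Y'" using V i V_eq_iff by auto
  thus ?thesis using card_far_eq[OF V(1,2)] card_far_eq[OF V(3,4)] card_far_less[OF V] i by simp
qed

lemma not_determined_by_spectrum: "\<not> determined_by_spectrum J"
proof
  assume det: "determined_by_spectrum J"
  obtain T where T: "T \<subseteq> U" "card T = 2 * m + 2" "finite T"
    using obtain_subset_with_card_n[of "2 * m + 2" U] card_U by auto
  interpret switched_middle_layer U m T by unfold_locales fact+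
  obtain f where f: "bij_betw f V V"
    and f_adj: "\<And>X Y. X \<in> V \<Longrightarrow> Y \<in> V \<Longrightarrow> (X, Y) \<in> parcs K \<longleftrightarrow> (f X, f Y) \<in> parcs J"
    using determined_by_spectrumD[OF det pair_graph_J pair_graph_K cospectral] by auto
  obtain A where A: "A \<subseteq> T" "card A = 2 * m" "finite A"
    using obtain_subset_with_card_n[of "2 * m" T] T by auto
  have "card (U - T) = 2 * m" using T card_U by (simp add: card_Diff_subset)
  hence "card (U - T) \<noteq> 0" using m_ge by simp
  hence "U - T \<noteq> {}" by (metis card.empty)
  then obtain w where w: "w \<in> U" "w \<notin> T" by blast
  \<comment> \<open>\<open>B\<close> has level \<open>2 * m\<close>, so it lies outside the
    switching sets and is alone in its cell. It meets \<open>T - {s}\<close> in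
    \<open>2 * m - 1\<close> or \<open>2 * m\<close> points, according to whether
    \<open>s \<in> A\<close>.\<close>
  define B where "B = insert w A"
  have "w \<notin> A" using w A by auto
  hence BV: "B \<in> V" using A w T by (auto simp: B_def V_def)
  have BT: "B \<inter> T = A" using A w by (auto simp: B_def)
  hence levB: "level B = 2 * m" using A by (simp add: level_def)
  hence nsB: "\<not> special B" "level B \<noteq> m + 1" using m_ge by (auto simp: special_def)
  have "A \<noteq> {}" using A m_ge by auto
  then obtain t where t: "t \<in> A" by blast
  hence tT: "t \<in> T" using A by auto
  have "card (T - A) = 2" using A T by (simp add: card_Diff_subset)
  hence "T - A \<noteq> {}" by force
  then obtain u where u: "u \<in> T" "u \<notin> A" by blast
  let ?X = "T - {t}"
  have XV: "?X \<in> V" using tT by (rule T_diff_in_V)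
  have "?X \<in> {X \<in> V. level X = 2 * m + 1}" using tT unfolding level_top by blast
  hence spX: "special ?X" "level ?X = 2 * m + 1" by (auto simp: special_def)
  hence "cell ?X = {X \<in> V. level X = 2 * m + 1}" by (simp add: cell_def)
  hence cellX: "cell ?X = (\<lambda>s. T - {s}) ` T" by (simp only: level_top)
  have card_B: "card (B \<inter> (T - {s})) = 2 * m - of_bool (s \<in> A)" if "s \<in> T" for s
    using card_Int_T_diff[OF that, of B] levB BT that by auto
  define c where "c s = card (common_nbrs J (T - {s}) B)" for s
  have c_cong: "c s = c s'" if "s \<in> T" "s' \<in> T" "s \<in> A \<longleftrightarrow> s' \<in> A" for s s'
    unfolding c_def using that card_B[of s] card_B[of s'] m_ge T_diff_in_V BV
    by (intro common_nbrs_cong) (auto simp: Int_commute)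
  have c_less: "c t < c u"
    unfolding c_def using tT t u card_B[of t] card_B[of u] m_ge T_diff_in_V BV
    by (intro common_nbrs_less) (auto simp: Int_commute)
  have "(\<Sum>Z\<in>cell ?X. card (common_nbrs J Z B)) = (\<Sum>s\<in>T. c s)"
    unfolding cellX c_def by (simp add: sum.reindex inj_on_T_diff)
  also have "\<dots> = (\<Sum>s\<in>A. c s) + (\<Sum>s\<in>T - A. c s)"
    using A T by (metis add.commute sum.subset_diff)
  also have "(\<Sum>s\<in>A. c s) = (\<Sum>s\<in>A. c t)"
    by (intro sum.cong refl c_cong) (use A t tT in auto)
  also have "(\<Sum>s\<in>T - A. c s) = (\<Sum>s\<in>T - A. c u)"
    by (intro sum.cong refl c_cong) (use u in auto)
  finally have "(\<Sum>Z\<in>cell ?X. card (common_nbrs J Z B)) = 2 * m * c t + 2 * c u"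
    using A \<open>card (T - A) = 2\<close> by simp
  moreover define d where "d = card (common_nbrs K ?X B)"
  ultimately have "(2 * m + 2) * (d + c t) = 2 * (2 * m * c t + 2 * c u)"
    using card_common_nbrs_switched[of ?X B] XV BV nsB card_special_cell[OF spX(1)]
    by (simp add: cell_def[of B] c_def)
  \<comment> \<open>Equivalently, \<open>(m + 1) * d = (m - 1) * c t + 2 * c u\<close>: a weighted
    mean with both weights positive, hence strictly between \<open>c t\<close> and
    \<open>c u\<close>.\<close>
  hence eq: "(m + 1) * d + c t = m * c t + 2 * c u"
    by (simp add: algebra_simps)
  have d_gt: "c t < d"
  proof (rule ccontr)
    assume "\<not> c t < d"
    hence "(m + 1) * d \<le> (m + 1) * c t" by (intro mult_le_mono) auto
    with eq c_less show False by simp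
  qed
  have d_lt: "d < c u"
  proof (rule ccontr)
    assume "\<not> d < c u"
    hence "(m + 1) * c u \<le> (m + 1) * d" by (intro mult_le_mono) auto
    moreover have "(m - 1) * c t < (m - 1) * c u" using c_less m_ge by simp
    ultimately show False using eq m_ge by (simp add: diff_mult_distrib)
  qed
  \<comment> \<open>The pair is not toggled, and it is non-adjacent because
    \<open>2 * m - 1 > m\<close>; this is where \<open>m \<ge> 2\<close> enters.\<close>
  have "\<not> flip ?X B" using spX nsB m_ge by (simp add: flip_def)
  moreover have "card (?X \<inter> B) = 2 * m - 1" using card_B[OF tT] t by (simp add: Int_commute)
  hence "(?X, B) \<notin> parcs J" using m_ge by (auto simp: parcs_J)
  ultimately have "(?X, B) \<notin> parcs K" using XV BV by (simp add: K_def)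
  hence nadj: "(f ?X, f B) \<notin> parcs J" using f_adj XV BV by simp
  have "?X \<noteq> B" using w by (auto simp: B_def)
  hence neq: "f ?X \<noteq> f B" using f XV BV by (auto simp: bij_betw_def dest: inj_onD)
  have fV: "f ?X \<in> V" "f B \<in> V" using f XV BV by (auto dest: bij_betwE)
  have d: "d = card (common_nbrs J (f ?X) (f B))"
    unfolding d_def by (rule card_common_nbrs_iso) (use f f_adj XV BV in auto)
  let ?i = "card (f ?X \<inter> f B)"
  have "?i \<noteq> 0"
  proof
    assume "?i = 0"
    hence "f B = U - f ?X" using disjoint_iff_compl[OF fV] by simp
    hence "d = 0" using d common_nbrs_compl[OF fV(1)] by simp
    with d_gt show False by simp
  qed
  hence i: "m + 1 \<le> ?i" using nadj fV by (auto simp: parcs_J)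
  have "?i \<le> 2 * m" using card_Int_le[OF fV(1), of "f B"] V_eq_iff[OF fV] neq by linarith
  \<comment> \<open>The image pair is distinct, non-adjacent and not complementary. By monotonicity
    its count is at most \<open>c t\<close> or equal to \<open>c u\<close>, and \<open>d\<close> is
    neither.\<close>
  then consider "?i < 2 * m - 1" | "?i = 2 * m - 1" | "?i = 2 * m" by linarith
  thus False
  proof cases
    case 1
    hence "d < c t" unfolding d c_def using i fV XV BV \<open>card (?X \<inter> B) = 2 * m - 1\<close>
      by (intro common_nbrs_less) auto
    with d_gt show False by simp
  next
    case 2
    hence "d = c t" unfolding d c_def using i fV XV BV \<open>card (?X \<inter> B) = 2 * m - 1\<close>
      by (intro common_nbrs_cong) auto
    with d_gt show False by simp
  next
    case 3
    hence "d = c u" unfolding d c_def using i fV BV card_B[OF u(1)] u T_diff_in_V[OF u(1)]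
      by (intro common_nbrs_cong) (auto simp: Int_commute)
    with d_lt show False by simp
  qed
qed

end

theorem theorem5p1:
  fixes k :: nat
  assumes "k \<ge> 5" and "odd k"
  shows "\<not> determined_by_spectrum (gen_johnson {1..(k - 1) div 2} (2 * k) k)"
proof -
  obtain m where k: "k = 2 * m + 1" using \<open>odd k\<close> by (rule oddE)
  interpret middle_layer "{1..2 * k}" m
    using \<open>k \<ge> 5\<close> k by unfold_locales auto
  \<comment> \<open>By \<open>m < k\<close> no set meets itself in a permitted number of points, so
    the arcs agree with those of \<open>J\<close>.\<close>
  have "(k - 1) div 2 = m" "m < k" using k by simp_all
  hence "gen_johnson {1..(k - 1) div 2} (2 * k) k = J"
    unfolding gen_johnson_def J_def V_def k[symmetric] by auto
  thus ?thesis using not_determined_by_spectrum by simp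
qed

end
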